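(* Let $\mathcal C$ be a topological category in which the product of any two discrete objects is discrete in $\mathcal C$, let $\mathbb T=(T,\eta,\mu)$ be a monad in $\mathcal C$, and let $\varphi:X\times Y\to Z$ be a binary operation in $\mathcal C$. (1) The binary operation $\varphi$ has at most one $\mathbb T$-extension $\Phi:TX\times TY\to TZ$. (2) If $X$ and $Y$ are discrete in $\mathcal C$, then $\varphi$ has a unique $\mathbb T$-extension $\Phi:TX\times TY\to TZ$.
   Context: A topological category is a subcategory $\mathcal C$ (not necessarily full) of the category of topological spaces and continuous maps such that: for any objects $X,Y$ of $\mathcal C$ each constant map $X\to Y$ is a morphism of $\mathcal C$; for any objects $X,Y$ of $\mathcal C$ the topological product $X\times Y$ is an object of $\mathcal C$, and for any object $Z$ and morphisms $f_X:Z\to X$, $f_Y:Z\to Y$ of $\mathcal C$ the map $(f_X,f_Y):Z\to X\times Y$ is a morphism of $\mathcal C$. A discrete topological space $X$ is called discrete in $\mathcal C$ (a discrete object) if $X$ is an object of $\mathcal C$ and every function from $X$ to any object of $\mathcal C$ is a morphism of $\mathcal C$. For a monad $\mathbb T=(T,\eta,\mu)$ in $\mathcal C$, the free $\mathbb T$-algebra over $X$ is $(TX,\mu_X)$; a morphism $h:TX\to TY$ of $\mathcal C$ is a morphism of free $\mathbb T$-algebras if $h\circ\mu_X=\mu_Y\circ Th$. A binary operation in $\mathcal C$ is any function $\varphi:X\times Y\to Z$ where $X,Y,Z$ are objects of $\mathcal C$ (it need not be a morphism). A binary operation $\Phi:TX\times TY\to TZ$ is a $\mathbb T$-extension of $\varphi$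 if: (1) $\Phi(\eta_X(x),\eta_Y(y))=\eta_Z(\varphi(x,y))$ for all $x\in X$, $y\in Y$; (2) for every $b\in TY$ the right shift $\Phi^b:TX\to TZ$, $a\mapsto\Phi(a,b)$, is a morphism of free $\mathbb T$-algebras; (3) for every $x\in X$ the left shift $\Phi_{\eta_X(x)}:TY\to TZ$, $b\mapsto\Phi(\eta_X(x),b)$, is a morphism of free $\mathbb T$-algebras. *)

theory Defs
  imports "HOL-Analysis.Analysis"
begin

text \<open>
  The points of all spaces of a category are drawn from one universe type \<open>'u\<close>: a space is a
  topology on some subset of \<open>'u\<close>. As in set theory, where the ordered pair is an injection
  of pairs of sets into sets, the universe comes with an injective ordered pair
  \<open>pr :: 'u \<times> 'u \<Rightarrow> 'u\<close>, so that the topological product of two spaces over \<open>'u\<close> is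
  again a space over \<open>'u\<close>.

  A map with domain \<open>X\<close> is a function that is undefined outside \<open>topspace X\<close>
  (\<open>\<rightarrow>\<^sub>E\<close>), so that equality of maps is equality in HOL; \<open>compose\<close> is the
  composition of such maps.
\<close>

definition product_space :: "('u \<times> 'u \<Rightarrow> 'u) \<Rightarrow> 'u topology \<Rightarrow> 'u topology \<Rightarrow> 'u topology"
  where "product_space pr X Y =
    pullback_topology (pr ` (topspace X \<times> topspace Y)) (inv pr) (prod_topology X Y)"

lemma topspace_product_space:
  assumes "inj pr"
  shows "topspace (product_space pr X Y) = pr ` (topspace X \<times> topspace Y)"
  using assms by (auto simp: product_space_def topspace_pullback_topology)

lemma homeomorphic_maps_product_space:
  assumes "inj pr"
  shows "homeomorphic_maps (prod_topology X Y) (product_space pr X Y) pr (inv pr)"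
  unfolding homeomorphic_maps_def
proof (intro conjI)
  show "continuous_map (prod_topology X Y) (product_space pr X Y) pr"
    unfolding continuous_map_def
  proof (intro conjI allI impI)
    show "pr \<in> topspace (prod_topology X Y) \<rightarrow> topspace (product_space pr X Y)"
      by (auto simp: topspace_product_space[OF assms])
  next
    fix U assume "openin (product_space pr X Y) U"
    then obtain W where W: "openin (prod_topology X Y) W"
      and U: "U = inv pr -` W \<inter> pr ` (topspace X \<times> topspace Y)"
      by (auto simp: product_space_def openin_pullback_topology)
    have "{x \<in> topspace (prod_topology X Y). pr x \<in> U} = W"
      using openin_subset[OF W] assms by (auto simp: U)
    then show "openin (prod_topology X Y) {x \<in> topspace (prod_topology X Y). pr x \<in> U}"
      using W by simp
  qed
next
  show "continuous_map (product_space pr X Y) (prod_topology X Y) (inv pr)"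
    unfolding product_space_def
    by (metis continuous_map_pullback continuous_map_id id_comp)
qed (use assms in \<open>auto simp: topspace_product_space\<close>)

record 'u spaces_category =
  objs :: "'u topology set"
  mors :: "'u topology \<Rightarrow> 'u topology \<Rightarrow> ('u \<Rightarrow> 'u) set"

locale spaces_subcategory =
  fixes C :: "'u spaces_category"
  assumes mor_map: "\<lbrakk>X \<in> objs C; Y \<in> objs C; f \<in> mors C X Y\<rbrakk>
      \<Longrightarrow> f \<in> topspace X \<rightarrow>\<^sub>E topspace Y"
    and mor_continuous: "\<lbrakk>X \<in> objs C; Y \<in> objs C; f \<in> mors C X Y\<rbrakk> \<Longrightarrow> continuous_map X Y f"
    and mor_id: "X \<in> objs C \<Longrightarrow> (\<lambda>x\<in>topspace X. x) \<in> mors C X X"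
    and mor_compose: "\<lbrakk>X \<in> objs C; Y \<in> objs C; Z \<in> objs C; f \<in> mors C X Y; g \<in> mors C Y Z\<rbrakk>
      \<Longrightarrow> compose (topspace X) g f \<in> mors C X Z"

locale topological_category = spaces_subcategory C
  for C :: "'u spaces_category" +
  fixes pr :: "'u \<times> 'u \<Rightarrow> 'u"
  assumes inj_pr: "inj pr"
    and mor_const: "\<lbrakk>X \<in> objs C; Y \<in> objs C; y \<in> topspace Y\<rbrakk>
      \<Longrightarrow> (\<lambda>x\<in>topspace X. y) \<in> mors C X Y"
    and product_obj: "\<lbrakk>X \<in> objs C; Y \<in> objs C\<rbrakk> \<Longrightarrow> product_space pr X Y \<in> objs C"
    and mor_pair: "\<lbrakk>X \<in> objs C; Y \<in> objs C; Z \<in> objs C; f \<in> mors C Z X; g \<in> mors C Z Y\<rbrakk>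
      \<Longrightarrow> (\<lambda>z\<in>topspace Z. pr (f z, g z)) \<in> mors C Z (product_space pr X Y)"

definition discrete_in :: "'u spaces_category \<Rightarrow> 'u topology \<Rightarrow> bool"
  where "discrete_in C X \<longleftrightarrow>
    X \<in> objs C \<and> X = discrete_topology (topspace X) \<and>
    (\<forall>Y\<in>objs C. \<forall>f \<in> topspace X \<rightarrow>\<^sub>E topspace Y. f \<in> mors C X Y)"

text \<open>
  A function does not determine its domain and codomain as spaces, so the action of the functor
  on a morphism \<open>f : X \<rightarrow> Y\<close> is written \<open>fun_mor T X Y f\<close>.
\<close>

record 'u monad_data =
  fun_obj :: "'u topology \<Rightarrow> 'u topology"
  fun_mor :: "'u topology \<Rightarrow> 'u topology \<Rightarrow> ('u \<Rightarrow> 'u) \<Rightarrow> 'u \<Rightarrow> 'u"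
  unit_map :: "'u topology \<Rightarrow> 'u \<Rightarrow> 'u"
  mult_map :: "'u topology \<Rightarrow> 'u \<Rightarrow> 'u"

locale endofunctor_in = spaces_subcategory C
  for C :: "'u spaces_category" +
  fixes T :: "'u monad_data"
  assumes fun_obj: "X \<in> objs C \<Longrightarrow> fun_obj T X \<in> objs C"
    and fun_mor: "\<lbrakk>X \<in> objs C; Y \<in> objs C; f \<in> mors C X Y\<rbrakk>
      \<Longrightarrow> fun_mor T X Y f \<in> mors C (fun_obj T X) (fun_obj T Y)"
    and fun_id: "X \<in> objs C
      \<Longrightarrow> fun_mor T X X (\<lambda>x\<in>topspace X. x) = (\<lambda>a\<in>topspace (fun_obj T X). a)"
    and fun_compose: "\<lbrakk>X \<in> objs C; Y \<in> objs C; Z \<in> objs C; f \<in> mors C X Y; g \<in> mors C Y Z\<rbrakk>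
      \<Longrightarrow> fun_mor T X Z (compose (topspace X) g f) =
        compose (topspace (fun_obj T X)) (fun_mor T Y Z g) (fun_mor T X Y f)"

locale monad_in = endofunctor_in C T
  for C :: "'u spaces_category" and T :: "'u monad_data" +
  assumes unit_mor: "X \<in> objs C \<Longrightarrow> unit_map T X \<in> mors C X (fun_obj T X)"
    and mult_mor: "X \<in> objs C
      \<Longrightarrow> mult_map T X \<in> mors C (fun_obj T (fun_obj T X)) (fun_obj T X)"
    and unit_natural: "\<lbrakk>X \<in> objs C; Y \<in> objs C; f \<in> mors C X Y\<rbrakk>
      \<Longrightarrow> compose (topspace X) (fun_mor T X Y f) (unit_map T X) =
        compose (topspace X) (unit_map T Y) f"
    and mult_natural: "\<lbrakk>X \<in> objs C; Y \<in> objs C; f \<in> mors C X Y\<rbrakk>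
      \<Longrightarrow> compose (topspace (fun_obj T (fun_obj T X))) (fun_mor T X Y f) (mult_map T X) =
        compose (topspace (fun_obj T (fun_obj T X))) (mult_map T Y)
          (fun_mor T (fun_obj T X) (fun_obj T Y) (fun_mor T X Y f))"
    and mult_unit: "X \<in> objs C
      \<Longrightarrow> compose (topspace (fun_obj T X)) (mult_map T X) (unit_map T (fun_obj T X)) =
        (\<lambda>a\<in>topspace (fun_obj T X). a)"
    and mult_fun_unit: "X \<in> objs C
      \<Longrightarrow> compose (topspace (fun_obj T X)) (mult_map T X)
          (fun_mor T X (fun_obj T X) (unit_map T X)) =
        (\<lambda>a\<in>topspace (fun_obj T X). a)"
    and mult_assoc: "X \<in> objs C
      \<Longrightarrow> compose (topspace (fun_obj T (fun_obj T (fun_obj T X))))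
          (mult_map T X) (mult_map T (fun_obj T X)) =
        compose (topspace (fun_obj T (fun_obj T (fun_obj T X)))) (mult_map T X)
          (fun_mor T (fun_obj T (fun_obj T X)) (fun_obj T X) (mult_map T X))"

definition free_algebra_morphism ::
    "'u spaces_category \<Rightarrow> 'u monad_data \<Rightarrow> 'u topology \<Rightarrow> 'u topology \<Rightarrow> ('u \<Rightarrow> 'u) \<Rightarrow> bool"
  where "free_algebra_morphism C T X Y h \<longleftrightarrow>
    h \<in> mors C (fun_obj T X) (fun_obj T Y) \<and>
    compose (topspace (fun_obj T (fun_obj T X))) h (mult_map T X) =
      compose (topspace (fun_obj T (fun_obj T X))) (mult_map T Y)
        (fun_mor T (fun_obj T X) (fun_obj T Y) h)"

text \<open>
  A binary operation need not be a morphism, so its argument is an ordinary pair rather than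
  a point of \<open>product_space pr X Y\<close>.
\<close>

definition binary_operation ::
    "'u spaces_category \<Rightarrow> 'u topology \<Rightarrow> 'u topology \<Rightarrow> 'u topology \<Rightarrow> ('u \<times> 'u \<Rightarrow> 'u) \<Rightarrow> bool"
  where "binary_operation C X Y Z \<phi> \<longleftrightarrow>
    X \<in> objs C \<and> Y \<in> objs C \<and> Z \<in> objs C \<and>
    \<phi> \<in> topspace X \<times> topspace Y \<rightarrow>\<^sub>E topspace Z"

definition monad_extension ::
    "'u spaces_category \<Rightarrow> 'u monad_data \<Rightarrow> 'u topology \<Rightarrow> 'u topology \<Rightarrow> 'u topology
      \<Rightarrow> ('u \<times> 'u \<Rightarrow> 'u) \<Rightarrow> ('u \<times> 'u \<Rightarrow> 'u) \<Rightarrow> bool"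
  where "monad_extension C T X Y Z \<phi> \<Phi> \<longleftrightarrow>
    binary_operation C (fun_obj T X) (fun_obj T Y) (fun_obj T Z) \<Phi> \<and>
    (\<forall>x\<in>topspace X. \<forall>y\<in>topspace Y.
      \<Phi> (unit_map T X x, unit_map T Y y) = unit_map T Z (\<phi> (x, y))) \<and>
    (\<forall>b\<in>topspace (fun_obj T Y).
      free_algebra_morphism C T X Z (\<lambda>a\<in>topspace (fun_obj T X). \<Phi> (a, b))) \<and>
    (\<forall>x\<in>topspace X.
      free_algebra_morphism C T Y Z (\<lambda>b\<in>topspace (fun_obj T Y). \<Phi> (unit_map T X x, b)))"

end

theory Submission
  imports Defs
begin

text \<open>
  A morphism of free algebras \<open>h : TX \<rightarrow> TY\<close> is the Kleisli extension of its restriction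
  \<open>h \<circ> \<eta>\<close>, since \<open>h = h \<circ> \<mu> \<circ> T\<eta> = \<mu> \<circ> T(h \<circ> \<eta>)\<close>; so it is determined by its values on
  \<open>\<eta>(X)\<close>. Applied to the left shifts at points \<open>\<eta>(x)\<close> and then to all right shifts, this gives
  uniqueness. If \<open>X\<close> and \<open>Y\<close> are discrete, all functions on them are morphisms, so one can first
  extend every \<open>\<phi>(x, \<cdot>)\<close> to \<open>TY\<close> and then, for each \<open>b\<close> in \<open>TY\<close>, the resulting function of
  \<open>x\<close> to \<open>TX\<close>.
\<close>

definition kleisli_extension ::
    "'u monad_data \<Rightarrow> 'u topology \<Rightarrow> 'u topology \<Rightarrow> ('u \<Rightarrow> 'u) \<Rightarrow> 'u \<Rightarrow> 'u"
  where "kleisli_extension T X Y f =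
    compose (topspace (fun_obj T X)) (mult_map T Y) (fun_mor T X (fun_obj T Y) f)"

context spaces_subcategory
begin

text \<open>The plain function space, without extensionality, is the form of premise that
  \<open>compose_assoc\<close> takes in the diagram chases below.\<close>

lemma mor_funcset:
  assumes "X \<in> objs C" "Y \<in> objs C" "f \<in> mors C X Y"
  shows "f \<in> topspace X \<rightarrow> topspace Y"
  using mor_map[OF assms] by (simp add: PiE_iff Pi_iff)

lemma mor_in_topspace:
  assumes "X \<in> objs C" "Y \<in> objs C" "f \<in> mors C X Y" "x \<in> topspace X"
  shows "f x \<in> topspace Y"
  using mor_map[OF assms(1-3)] assms(4) by (rule PiE_mem)

lemma mor_compose_id:
  assumes "X \<in> objs C" "Y \<in> objs C" "f \<in> mors C X Y"
  shows "compose (topspace X) f (\<lambda>x\<in>topspace X. x) = f"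
  using mor_map[OF assms] by (intro compose_Id[OF mor_funcset[OF assms]]) (simp add: PiE_def)

end

context monad_in
begin

lemma kleisli_extension_mor:
  assumes "X \<in> objs C" "Y \<in> objs C" "f \<in> mors C X (fun_obj T Y)"
  shows "kleisli_extension T X Y f \<in> mors C (fun_obj T X) (fun_obj T Y)"
  unfolding kleisli_extension_def
  using assms by (intro mor_compose[where Y = "fun_obj T (fun_obj T Y)"] fun_obj fun_mor mult_mor)

text \<open>Naturality of the unit moves \<open>f\<close> past \<eta>, and a unit law cancels the
  rest: \<mu>_Y \<circ> Tf \<circ> \<eta>_X = \<mu>_Y \<circ> \<eta>_{TY} \<circ> f = f.\<close>

lemma kleisli_extension_unit:
  assumes X: "X \<in> objs C" and Y: "Y \<in> objs C" and f: "f \<in> mors C X (fun_obj T Y)"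
    and x: "x \<in> topspace X"
  shows "kleisli_extension T X Y f (unit_map T X x) = f x"
proof -
  have TY: "fun_obj T Y \<in> objs C" using Y by (rule fun_obj)
  have "unit_map T X x \<in> topspace (fun_obj T X)"
    using mor_in_topspace[OF X fun_obj[OF X] unit_mor[OF X] x] .
  then have "kleisli_extension T X Y f (unit_map T X x) =
      mult_map T Y (fun_mor T X (fun_obj T Y) f (unit_map T X x))"
    by (simp add: kleisli_extension_def compose_eq)
  also have "fun_mor T X (fun_obj T Y) f (unit_map T X x) = unit_map T (fun_obj T Y) (f x)"
    using fun_cong[OF unit_natural[OF X TY f], of x] x by (simp add: compose_eq)
  also have "mult_map T Y (unit_map T (fun_obj T Y) (f x)) = f x"
    using fun_cong[OF mult_unit[OF Y], of "f x"] mor_in_topspace[OF X TY f x]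
    by (simp add: compose_eq)
  finally show ?thesis .
qed

text \<open>Naturality of \<mu>, associativity and functoriality give, in this order, \<mu>_Y
  \<circ> Tf \<circ> \<mu>_X = \<mu>_Y \<circ> \<mu>_{TY} \<circ> TTf = \<mu>_Y \<circ> T\<mu>_Y
  \<circ> TTf = \<mu>_Y \<circ> T(\<mu>_Y \<circ> Tf). The remaining links of the chain only move
  brackets.\<close>

lemma free_algebra_morphism_kleisli_extension:
  assumes X: "X \<in> objs C" and Y: "Y \<in> objs C" and f: "f \<in> mors C X (fun_obj T Y)"
  shows "free_algebra_morphism C T X Y (kleisli_extension T X Y f)"
  unfolding free_algebra_morphism_def
proof
  show "kleisli_extension T X Y f \<in> mors C (fun_obj T X) (fun_obj T Y)"
    using assms by (rule kleisli_extension_mor)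
next
  let ?TX = "fun_obj T X" and ?TY = "fun_obj T Y"
  let ?TTX = "fun_obj T ?TX" and ?TTY = "fun_obj T ?TY"
  let ?TTTY = "fun_obj T ?TTY"
  let ?Tf = "fun_mor T X ?TY f"
  let ?TTf = "fun_mor T ?TX ?TTY ?Tf"
  have objs: "?TX \<in> objs C" "?TY \<in> objs C" "?TTX \<in> objs C" "?TTY \<in> objs C" "?TTTY \<in> objs C"
    using X Y by (simp_all add: fun_obj)
  have Tf: "?Tf \<in> mors C ?TX ?TTY"
    using X objs(2) f by (rule fun_mor)
  have TTf: "?TTf \<in> mors C ?TTX ?TTTY"
    using objs(1,4) Tf by (rule fun_mor)
  have "compose (topspace ?TTX) (kleisli_extension T X Y f) (mult_map T X) =
      compose (topspace ?TTX) (mult_map T Y) (compose (topspace ?TTX) ?Tf (mult_map T X))"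
    unfolding kleisli_extension_def
    by (rule compose_assoc[symmetric]) (rule mor_funcset[OF objs(3,1) mult_mor[OF X]])
  also have "\<dots> = compose (topspace ?TTX) (mult_map T Y)
      (compose (topspace ?TTX) (mult_map T ?TY) ?TTf)"
    by (simp add: mult_natural[OF X objs(2) f])
  also have "\<dots> = compose (topspace ?TTX)
      (compose (topspace ?TTTY) (mult_map T Y) (mult_map T ?TY)) ?TTf"
    by (rule compose_assoc) (rule mor_funcset[OF objs(3,5) TTf])
  also have "\<dots> = compose (topspace ?TTX)
      (compose (topspace ?TTTY) (mult_map T Y) (fun_mor T ?TTY ?TY (mult_map T Y))) ?TTf"
    by (simp add: mult_assoc[OF Y])
  also have "\<dots> = compose (topspace ?TTX) (mult_map T Y)
      (compose (topspace ?TTX) (fun_mor T ?TTY ?TY (mult_map T Y)) ?TTf)"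
    by (rule compose_assoc[symmetric]) (rule mor_funcset[OF objs(3,5) TTf])
  also have "compose (topspace ?TTX) (fun_mor T ?TTY ?TY (mult_map T Y)) ?TTf =
      fun_mor T ?TX ?TY (kleisli_extension T X Y f)"
    unfolding kleisli_extension_def
    by (rule fun_compose[OF objs(1,4,2) Tf mult_mor[OF Y], symmetric])
  finally show "compose (topspace ?TTX) (kleisli_extension T X Y f) (mult_map T X) =
      compose (topspace ?TTX) (mult_map T Y) (fun_mor T ?TX ?TY (kleisli_extension T X Y f))" .
qed

lemma free_algebra_morphism_eq_kleisli_extension:
  assumes X: "X \<in> objs C" and Y: "Y \<in> objs C" and h: "free_algebra_morphism C T X Y h"
  shows "h = kleisli_extension T X Y (compose (topspace X) h (unit_map T X))"
proof -
  let ?TX = "fun_obj T X" and ?TY = "fun_obj T Y"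
  let ?TTX = "fun_obj T ?TX" and ?TTY = "fun_obj T ?TY"
  let ?T\<eta> = "fun_mor T X ?TX (unit_map T X)"
  have objs: "?TX \<in> objs C" "?TY \<in> objs C" "?TTX \<in> objs C"
    using X Y by (simp_all add: fun_obj)
  have hm: "h \<in> mors C ?TX ?TY"
    and hmult: "compose (topspace ?TTX) h (mult_map T X) =
      compose (topspace ?TTX) (mult_map T Y) (fun_mor T ?TX ?TY h)"
    using h by (simp_all add: free_algebra_morphism_def)
  have T\<eta>: "?T\<eta> \<in> topspace ?TX \<rightarrow> topspace ?TTX"
    using mor_funcset[OF objs(1,3) fun_mor[OF X objs(1) unit_mor[OF X]]] .
  \<comment> \<open>The identity of TX is inserted as \<mu>_X \<circ> T\<eta>_X. This puts
    \<open>h\<close> next to \<mu>_X, where \<open>hmult\<close> turns it into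
    \<open>T h\<close>.\<close>
  have "h = compose (topspace ?TX) h (compose (topspace ?TX) (mult_map T X) ?T\<eta>)"
    by (simp add: mult_fun_unit[OF X] mor_compose_id[OF objs(1,2) hm])
  also have "\<dots> = compose (topspace ?TX) (compose (topspace ?TTX) h (mult_map T X)) ?T\<eta>"
    using T\<eta> by (rule compose_assoc)
  also have "\<dots> = compose (topspace ?TX) (mult_map T Y)
      (compose (topspace ?TX) (fun_mor T ?TX ?TY h) ?T\<eta>)"
    unfolding hmult using T\<eta> by (rule compose_assoc[symmetric])
  also have "\<dots> = kleisli_extension T X Y (compose (topspace X) h (unit_map T X))"
    unfolding kleisli_extension_def
    by (simp add: fun_compose[OF X objs(1,2) unit_mor[OF X] hm])
  finally show ?thesis .
qed

lemma free_algebra_morphism_eqI: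
  assumes "X \<in> objs C" "Y \<in> objs C"
    and "free_algebra_morphism C T X Y g" "free_algebra_morphism C T X Y h"
    and "\<And>x. x \<in> topspace X \<Longrightarrow> g (unit_map T X x) = h (unit_map T X x)"
  shows "g = h"
proof -
  \<comment> \<open>\<open>compose\<close> is undefined outside \<open>topspace X\<close>, so
    agreement at the points \<eta>(x) is already equality of HOL functions.\<close>
  have "compose (topspace X) g (unit_map T X) = compose (topspace X) h (unit_map T X)"
    using assms(5) by (auto simp: compose_def)
  then show ?thesis
    using free_algebra_morphism_eq_kleisli_extension[OF assms(1-3)]
      free_algebra_morphism_eq_kleisli_extension[OF assms(1,2,4)] by argo
qed

lemma monad_extension_unique:
  assumes \<phi>: "binary_operation C X Y Z \<phi>"
    and \<Phi>: "monad_extension C T X Y Z \<phi> \<Phi>" and \<Psi>: "monad_extension C T X Y Z \<phi> \<Psi>"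
  shows "\<Phi> = \<Psi>"
proof -
  let ?TX = "fun_obj T X" and ?TY = "fun_obj T Y"
  have X: "X \<in> objs C" and Y: "Y \<in> objs C" and Z: "Z \<in> objs C"
    using \<phi> by (simp_all add: binary_operation_def)
  have unit_X: "unit_map T X x \<in> topspace ?TX" if "x \<in> topspace X" for x
    using mor_in_topspace[OF X fun_obj[OF X] unit_mor[OF X] that] .
  have unit_Y: "unit_map T Y y \<in> topspace ?TY" if "y \<in> topspace Y" for y
    using mor_in_topspace[OF Y fun_obj[OF Y] unit_mor[OF Y] that] .
  \<comment> \<open>Left shifts are algebra morphisms only at points \<eta>(x), so agreement comes
    first on \<eta>(X) \<times> TY. This is the agreement on units that the right shifts need in
    \<open>right\<close>.\<close>
  have left: "\<Phi> (unit_map T X x, b) = \<Psi> (unit_map T X x, b)"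
    if x: "x \<in> topspace X" and b: "b \<in> topspace ?TY" for x b
  proof -
    have "(\<lambda>b\<in>topspace ?TY. \<Phi> (unit_map T X x, b)) = (\<lambda>b\<in>topspace ?TY. \<Psi> (unit_map T X x, b))"
      using \<Phi> \<Psi> x
      by (intro free_algebra_morphism_eqI[OF Y Z]) (simp_all add: monad_extension_def unit_Y)
    from fun_cong[OF this, of b] b show ?thesis by simp
  qed
  have right: "\<Phi> (a, b) = \<Psi> (a, b)" if a: "a \<in> topspace ?TX" and b: "b \<in> topspace ?TY" for a b
  proof -
    have "(\<lambda>a\<in>topspace ?TX. \<Phi> (a, b)) = (\<lambda>a\<in>topspace ?TX. \<Psi> (a, b))"
      using \<Phi> \<Psi> b
      by (intro free_algebra_morphism_eqI[OF X Z]) (simp_all add: monad_extension_def unit_X left)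
    from fun_cong[OF this, of a] a show ?thesis by simp
  qed
  \<comment> \<open>Both operations are undefined off TX \<times> TY, so \<open>right\<close>
    settles equality as functions.\<close>
  show ?thesis
  proof (rule PiE_ext)
    show "\<Phi> \<in> topspace ?TX \<times> topspace ?TY \<rightarrow>\<^sub>E topspace (fun_obj T Z)"
      "\<Psi> \<in> topspace ?TX \<times> topspace ?TY \<rightarrow>\<^sub>E topspace (fun_obj T Z)"
      using \<Phi> \<Psi> by (simp_all add: monad_extension_def binary_operation_def)
  qed (auto simp: right)
qed

lemma monad_extension_exists:
  assumes \<phi>: "binary_operation C X Y Z \<phi>"
    and dX: "discrete_in C X" and dY: "discrete_in C Y"
  shows "\<exists>\<Phi>. monad_extension C T X Y Z \<phi> \<Phi>"
proof -
  let ?TX = "fun_obj T X" and ?TY = "fun_obj T Y" and ?TZ = "fun_obj T Z"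
  have X: "X \<in> objs C" and Y: "Y \<in> objs C" and Z: "Z \<in> objs C"
    and \<phi>_map: "\<phi> \<in> topspace X \<times> topspace Y \<rightarrow>\<^sub>E topspace Z"
    using \<phi> by (simp_all add: binary_operation_def)
  note TX = fun_obj[OF X] and TY = fun_obj[OF Y] and TZ = fun_obj[OF Z]
  have unit_X: "unit_map T X x \<in> topspace ?TX" if "x \<in> topspace X" for x
    using mor_in_topspace[OF X TX unit_mor[OF X] that] .
  have unit_Y: "unit_map T Y y \<in> topspace ?TY" if "y \<in> topspace Y" for y
    using mor_in_topspace[OF Y TY unit_mor[OF Y] that] .
  \<comment> \<open>\<open>L x\<close> will be the left shift of \<open>\<Phi>\<close> at \<eta>(x)
    and \<open>R b\<close> its right shift at \<open>b\<close>; \<open>l x\<close> and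
    \<open>r b\<close> are their prescribed values on units.\<close>
  define l where "l x = (\<lambda>y\<in>topspace Y. unit_map T Z (\<phi> (x, y)))" for x
  define L where "L x = kleisli_extension T Y Z (l x)" for x
  define r where "r b = (\<lambda>x\<in>topspace X. L x b)" for b
  define R where "R b = kleisli_extension T X Z (r b)" for b
  define \<Phi> where "\<Phi> = (\<lambda>(a, b)\<in>topspace ?TX \<times> topspace ?TY. R b a)"
  \<comment> \<open>The map \<phi>(x, \<cdot>) is arbitrary, so it is the discreteness of Y that
    makes \<open>l x\<close> a morphism.\<close>
  have l: "l x \<in> mors C Y ?TZ" if x: "x \<in> topspace X" for x
  proof -
    have "unit_map T Z (\<phi> (x, y)) \<in> topspace ?TZ" if "y \<in> topspace Y" for y
      using mor_in_topspace[OF Z TZ unit_mor[OF Z] PiE_mem[OF \<phi>_map]] x that by simp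
    then have "l x \<in> topspace Y \<rightarrow>\<^sub>E topspace ?TZ" by (simp add: l_def)
    then show ?thesis using dY TZ by (simp add: discrete_in_def)
  qed
  have L_mor: "L x \<in> mors C ?TY ?TZ" if "x \<in> topspace X" for x
    unfolding L_def using kleisli_extension_mor[OF Y Z l[OF that]] .
  \<comment> \<open>Nothing relates the maps \<open>L x\<close> for different x, so here the
    discreteness of X is what gives a morphism.\<close>
  have r: "r b \<in> mors C X ?TZ" if b: "b \<in> topspace ?TY" for b
  proof -
    have "r b \<in> topspace X \<rightarrow>\<^sub>E topspace ?TZ"
      using mor_in_topspace[OF TY TZ L_mor b] by (simp add: r_def)
    then show ?thesis using dX TZ by (simp add: discrete_in_def)
  qed
  have R_mor: "R b \<in> mors C ?TX ?TZ" if "b \<in> topspace ?TY" for b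
    unfolding R_def using kleisli_extension_mor[OF X Z r[OF that]] .
  \<comment> \<open>The two extensions fit together: restricted to units, the right shifts return
    the left shifts they were built from.\<close>
  have R_unit: "R b (unit_map T X x) = L x b" if "x \<in> topspace X" "b \<in> topspace ?TY" for x b
    using kleisli_extension_unit[OF X Z r[OF that(2)] that(1)] that(1)
    by (simp add: R_def r_def)
  \<comment> \<open>Outside TX both sides are \<open>undefined\<close>: the left by restriction,
    \<open>R b\<close> because morphisms are extensional (\<open>PiE_arb\<close>).\<close>
  have right_shift: "(\<lambda>a\<in>topspace ?TX. \<Phi> (a, b)) = R b" if "b \<in> topspace ?TY" for b
    using that PiE_arb[OF mor_map[OF TX TZ R_mor]] by (auto simp: \<Phi>_def fun_eq_iff)
  have left_shift: "(\<lambda>b\<in>topspace ?TY. \<Phi> (unit_map T X x, b)) = L x" if "x \<in> topspace X" for x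
    using that PiE_arb[OF mor_map[OF TY TZ L_mor]] by (auto simp: \<Phi>_def fun_eq_iff unit_X R_unit)
  have "monad_extension C T X Y Z \<phi> \<Phi>"
    unfolding monad_extension_def
  proof (intro conjI ballI)
    show "binary_operation C ?TX ?TY ?TZ \<Phi>"
      using TX TY TZ mor_in_topspace[OF TX TZ R_mor]
      by (auto simp: binary_operation_def \<Phi>_def)
  next
    fix x y assume xy: "x \<in> topspace X" "y \<in> topspace Y"
    then have "\<Phi> (unit_map T X x, unit_map T Y y) = L x (unit_map T Y y)"
      by (simp add: \<Phi>_def unit_X unit_Y R_unit)
    also have "\<dots> = unit_map T Z (\<phi> (x, y))"
      using kleisli_extension_unit[OF Y Z l[OF xy(1)] xy(2)] xy(2) by (simp add: L_def l_def)
    finally show "\<Phi> (unit_map T X x, unit_map T Y y) = unit_map T Z (\<phi> (x, y))" .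
  next
    fix b assume b: "b \<in> topspace ?TY"
    show "free_algebra_morphism C T X Z (\<lambda>a\<in>topspace ?TX. \<Phi> (a, b))"
      unfolding right_shift[OF b] R_def
      using X Z r[OF b] by (rule free_algebra_morphism_kleisli_extension)
  next
    fix x assume x: "x \<in> topspace X"
    show "free_algebra_morphism C T Y Z (\<lambda>b\<in>topspace ?TY. \<Phi> (unit_map T X x, b))"
      unfolding left_shift[OF x] L_def
      using Y Z l[OF x] by (rule free_algebra_morphism_kleisli_extension)
  qed
  then show ?thesis by blast
qed

end

theorem theorem2p2:
  fixes C :: "'u spaces_category" and pr :: "'u \<times> 'u \<Rightarrow> 'u" and T :: "'u monad_data"
    and X Y Z :: "'u topology" and \<phi> :: "'u \<times> 'u \<Rightarrow> 'u"
  assumes "topological_category C pr"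
    and "\<And>A B. discrete_in C A \<Longrightarrow> discrete_in C B \<Longrightarrow> discrete_in C (product_space pr A B)"
    and "monad_in C T"
    and "binary_operation C X Y Z \<phi>"
  shows "(\<exists>\<^sub>\<le>\<^sub>1 \<Phi>. monad_extension C T X Y Z \<phi> \<Phi>) \<and>
    (discrete_in C X \<and> discrete_in C Y \<longrightarrow> (\<exists>!\<Phi>. monad_extension C T X Y Z \<phi> \<Phi>))"
proof -
  interpret monad_in C T by fact
  note unique = monad_extension_unique[OF assms(4)]
  have "\<exists>\<^sub>\<le>\<^sub>1 \<Phi>. monad_extension C T X Y Z \<phi> \<Phi>"
    using unique by (intro Uniq_I)
  moreover have "\<exists>!\<Phi>. monad_extension C T X Y Z \<phi> \<Phi>"
    if "discrete_in C X" "discrete_in C Y"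
    using monad_extension_exists[OF assms(4) that] unique by blast
  ultimately show ?thesis by blast
qed

end
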